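(* Let $n \ge 1$ and $N \ge 1$ be integers, let $A=(a_{ij}) \in \mathbb{R}^{n\times n}$ be a symmetric positive semidefinite matrix with positive diagonal ($a_{ii}>0$ for all $i$), and let $b \in \mathbb{R}^n$ be such that the linear system $Ax=b$ is solvable; let $x^\star$ denote a solution. Let $f(x)=\tfrac12 x^\top A x - b^\top x$, let $D=\mathrm{diag}(a_{11},\dots,a_{nn})$, let $L=\lambda_{\max}(D^{-1}A)$ be the largest eigenvalue of $D^{-1}A$ (all its eigenvalues are real), and let $\|u\|_D=\sqrt{\langle u,u\rangle_D}$ be the norm induced by the inner product $\langle u,v\rangle_D=\sum_{i=1}^n a_{ii}u_iv_i$ on $\mathbb{R}^n$. Let $\Delta \ge 0$ and let $x^0\in\mathbb{R}^n$ satisfy $\|x^0-x^\star\|_D^2\le \Delta$. Let $x^1,\dots,x^N$ be generated from $x^0$ by $N$ iterations of the Gauss-Seidel method, i.e., for $k=0,1,\dots,N-1$, $$x_i^{k+1}=\frac{1}{a_{ii}}\Big(b_i-\sum_{j=1}^{i-1}a_{ij}x_j^{k+1}-\sum_{j=i+1}^{n}a_{ij}x_j^{k}\Big),\qquad i=1,\dots,n.$$ Then $$f(x^N)-f(x^\star)\le \mathrm{val}(n,N,L,\Delta),$$ where $\mathrm{val}(n,N,L,\Delta)$ is the optimal value of the semidefinite performance estimation problem defined in the context.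
   Context: Definition of the semidefinite program with parameters $n,N\ge 1$ integers, $L>0$, $\Delta\ge 0$. It is the performance estimation problem for $N$ cycles ($M:=nN$ coordinate steps) of cyclic coordinate descent with unit step lengths, for convex quadratic functions, with smoothness constant $L$ and all coordinate-wise smoothness constants equal to $1$. The minimizer is placed at the origin. Put $p:=n+n(M+1)$ and for $k\in\{0,\dots,M-1\}$ let $i(k):=(k \bmod n)+1\in\{1,\dots,n\}$. Label the $p$ standard unit vectors of $\mathbb{R}^p$ as $\mathbf{x}^0_i$ ($1\le i\le n$) and $\mathbf{g}^k_i$ ($0\le k\le M$, $1\le i\le n$). Define recursively, for $0\le k\le M-1$, $$\mathbf{x}^{k+1}_i=\mathbf{x}^k_i-\mathbf{g}^k_i \ \text{ if } i=i(k),\qquad \mathbf{x}^{k+1}_i=\mathbf{x}^k_i \ \text{ otherwise},$$ and set $\mathbf{x}^\star_i=\mathbf{g}^\star_i=0\in\mathbb{R}^p$ for all $i$. The decision variables are a symmetric positive semidefinite matrix $G\in\mathbb{R}^{p\times p}$ and real numbers $f^0,\dots,f^M,f^\star$. Write $\langle u,v\rangle_G:=u^\top G v$ for $u,v\in\mathbb{R}^p$. The problem is to maximize $f^M-f^\star$ subject to $G\succeq 0$ and: (1) (convexity and $L$-smoothness) for all $r,s\in\{0,1,\dots,M,\star\}$, $$f^r\ge f^s+\sum_{i=1}^n\langle \mathbf{g}^s_i,\mathbf{x}^r_i-\mathbf{x}^s_i\rangle_G+\frac{1}{2L}\sum_{i=1}^n\langle \mathbf{g}^r_i-\mathbf{g}^s_i,\mathbf{g}^r_i-\mathbf{g}^s_i\rangle_G;$$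 (2) (quadratic function) for all $r,s\in\{0,1,\dots,M,\star\}$, $$\frac12\sum_{i=1}^n\langle \mathbf{g}^r_i-\mathbf{g}^s_i,\mathbf{x}^r_i-\mathbf{x}^s_i\rangle_G=f^r-f^s-\sum_{i=1}^n\langle \mathbf{g}^s_i,\mathbf{x}^r_i-\mathbf{x}^s_i\rangle_G;$$ (3) (coordinate-wise smoothness with constant $1$) for all $k\in\{0,\dots,M-1\}$, with $i=i(k)$, $$f^k\ge f^{k+1}+\langle \mathbf{g}^{k+1}_i,\mathbf{x}^k_i-\mathbf{x}^{k+1}_i\rangle_G+\frac12\langle \mathbf{g}^k_i-\mathbf{g}^{k+1}_i,\mathbf{g}^k_i-\mathbf{g}^{k+1}_i\rangle_G,$$ $$f^{k+1}\ge f^{k}+\langle \mathbf{g}^{k}_i,\mathbf{x}^{k+1}_i-\mathbf{x}^{k}_i\rangle_G+\frac12\langle \mathbf{g}^{k+1}_i-\mathbf{g}^{k}_i,\mathbf{g}^{k+1}_i-\mathbf{g}^{k}_i\rangle_G;$$ (4) (initial distance) $\sum_{i=1}^n\langle \mathbf{x}^0_i,\mathbf{x}^0_i\rangle_G\le\Delta$. The optimal value $\mathrm{val}(n,N,L,\Delta)$ is the supremum of $f^M-f^\star$ over all feasible $(G,f^0,\dots,f^M,f^\star)$, as an element of $[-\infty,+\infty]$. *)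

theory Defs
  imports
    "Jordan_Normal_Form.Spectral_Radius"
    "Jordan_Normal_Form.Gauss_Jordan_Elimination"
    "HOL-Library.Extended_Real"
begin

text \<open>All coordinate indices are shifted to start at 0, as usual for the matrix type used here:
  coordinates range over \<open>i < n\<close>, and the coordinate updated in step \<open>k\<close> is \<open>k mod n\<close>.\<close>

definition psd_mat :: "nat \<Rightarrow> real mat \<Rightarrow> bool" where
  "psd_mat n A \<longleftrightarrow> A \<in> carrier_mat n n \<and> transpose_mat A = A \<and>
     (\<forall>v \<in> carrier_vec n. 0 \<le> v \<bullet> (A *\<^sub>v v))"

definition diag_part :: "real mat \<Rightarrow> real mat" where
  "diag_part A = mat_diag (dim_row A) (\<lambda>i. A $$ (i, i))"

text \<open>Only real eigenvalues are collected, so this is the largest eigenvalue for matrices whose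
  complex spectrum is real and nonempty; it is unspecified if there is no real eigenvalue.\<close>

definition lambda_max :: "real mat \<Rightarrow> real" where
  "lambda_max A = Max (spectrum A)"

definition inner_D :: "real mat \<Rightarrow> real vec \<Rightarrow> real vec \<Rightarrow> real" where
  "inner_D A u v = (\<Sum>i<dim_row A. A $$ (i, i) * u $ i * v $ i)"

definition norm_D :: "real mat \<Rightarrow> real vec \<Rightarrow> real" where
  "norm_D A u = sqrt (inner_D A u u)"

definition quad_fun :: "real mat \<Rightarrow> real vec \<Rightarrow> real vec \<Rightarrow> real" where
  "quad_fun A b x = 1 / 2 * (x \<bullet> (A *\<^sub>v x)) - b \<bullet> x"

definition gauss_seidel :: "nat \<Rightarrow> real mat \<Rightarrow> real vec \<Rightarrow> nat \<Rightarrow> (nat \<Rightarrow> real vec) \<Rightarrow> bool" where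
  "gauss_seidel n A b N x \<longleftrightarrow>
     (\<forall>k\<le>N. x k \<in> carrier_vec n) \<and>
     (\<forall>k<N. \<forall>i<n. x (Suc k) $ i =
        1 / A $$ (i, i) *
          (b $ i - (\<Sum>j\<in>{0..<i}. A $$ (i, j) * x (Suc k) $ j)
                 - (\<Sum>j\<in>{Suc i..<n}. A $$ (i, j) * x k $ j)))"


definition pep_steps :: "nat \<Rightarrow> nat \<Rightarrow> nat" where
  "pep_steps n N = n * N"

definition pep_dim :: "nat \<Rightarrow> nat \<Rightarrow> nat" where
  "pep_dim n N = n + n * (pep_steps n N + 1)"

datatype pep_index = Iter nat | Star

definition pep_indices :: "nat \<Rightarrow> nat \<Rightarrow> pep_index set" where
  "pep_indices n N = insert Star (Iter ` {0..pep_steps n N})"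

text \<open>Labelling of the standard unit vectors: position \<open>i\<close> is the \<open>i\<close>-th block of the initial
  point, position \<open>n + k * n + i\<close> is the \<open>i\<close>-th block of the \<open>k\<close>-th gradient.\<close>

definition grad_iter :: "nat \<Rightarrow> nat \<Rightarrow> nat \<Rightarrow> nat \<Rightarrow> real vec" where
  "grad_iter n N k i = unit_vec (pep_dim n N) (n + k * n + i)"

primrec point_iter :: "nat \<Rightarrow> nat \<Rightarrow> nat \<Rightarrow> nat \<Rightarrow> real vec" where
  "point_iter n N 0 i = unit_vec (pep_dim n N) i"
| "point_iter n N (Suc k) i =
     (if i = k mod n then point_iter n N k i - grad_iter n N k i else point_iter n N k i)"

fun pep_g :: "nat \<Rightarrow> nat \<Rightarrow> pep_index \<Rightarrow> nat \<Rightarrow> real vec" where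
  "pep_g n N (Iter k) i = grad_iter n N k i"
| "pep_g n N Star i = 0\<^sub>v (pep_dim n N)"

fun pep_x :: "nat \<Rightarrow> nat \<Rightarrow> pep_index \<Rightarrow> nat \<Rightarrow> real vec" where
  "pep_x n N (Iter k) i = point_iter n N k i"
| "pep_x n N Star i = 0\<^sub>v (pep_dim n N)"

definition inner_G :: "real mat \<Rightarrow> real vec \<Rightarrow> real vec \<Rightarrow> real" where
  "inner_G G u v = u \<bullet> (G *\<^sub>v v)"

definition pep_smooth :: "nat \<Rightarrow> nat \<Rightarrow> real \<Rightarrow> real mat \<Rightarrow> (pep_index \<Rightarrow> real) \<Rightarrow> bool" where
  "pep_smooth n N L G f \<longleftrightarrow>
     (\<forall>r \<in> pep_indices n N. \<forall>s \<in> pep_indices n N.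
        f r \<ge> f s + (\<Sum>i<n. inner_G G (pep_g n N s i) (pep_x n N r i - pep_x n N s i))
          + 1 / (2 * L) *
            (\<Sum>i<n. inner_G G (pep_g n N r i - pep_g n N s i) (pep_g n N r i - pep_g n N s i)))"

definition pep_quadratic :: "nat \<Rightarrow> nat \<Rightarrow> real mat \<Rightarrow> (pep_index \<Rightarrow> real) \<Rightarrow> bool" where
  "pep_quadratic n N G f \<longleftrightarrow>
     (\<forall>r \<in> pep_indices n N. \<forall>s \<in> pep_indices n N.
        1 / 2 * (\<Sum>i<n. inner_G G (pep_g n N r i - pep_g n N s i) (pep_x n N r i - pep_x n N s i))
        = f r - f s - (\<Sum>i<n. inner_G G (pep_g n N s i) (pep_x n N r i - pep_x n N s i)))"

definition coord_smooth_ineq ::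
  "nat \<Rightarrow> nat \<Rightarrow> real mat \<Rightarrow> (pep_index \<Rightarrow> real) \<Rightarrow> nat \<Rightarrow> pep_index \<Rightarrow> pep_index \<Rightarrow> bool" where
  "coord_smooth_ineq n N G f i r s \<longleftrightarrow>
     f r \<ge> f s + inner_G G (pep_g n N s i) (pep_x n N r i - pep_x n N s i)
       + 1 / 2 * inner_G G (pep_g n N r i - pep_g n N s i) (pep_g n N r i - pep_g n N s i)"

definition pep_coord_smooth :: "nat \<Rightarrow> nat \<Rightarrow> real mat \<Rightarrow> (pep_index \<Rightarrow> real) \<Rightarrow> bool" where
  "pep_coord_smooth n N G f \<longleftrightarrow>
     (\<forall>k<pep_steps n N.
        coord_smooth_ineq n N G f (k mod n) (Iter k) (Iter (Suc k)) \<and>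
        coord_smooth_ineq n N G f (k mod n) (Iter (Suc k)) (Iter k))"

definition pep_initial :: "nat \<Rightarrow> nat \<Rightarrow> real \<Rightarrow> real mat \<Rightarrow> bool" where
  "pep_initial n N \<Delta> G \<longleftrightarrow>
     (\<Sum>i<n. inner_G G (pep_x n N (Iter 0) i) (pep_x n N (Iter 0) i)) \<le> \<Delta>"

definition pep_feasible ::
  "nat \<Rightarrow> nat \<Rightarrow> real \<Rightarrow> real \<Rightarrow> real mat \<Rightarrow> (pep_index \<Rightarrow> real) \<Rightarrow> bool" where
  "pep_feasible n N L \<Delta> G f \<longleftrightarrow>
     psd_mat (pep_dim n N) G \<and> pep_smooth n N L G f \<and> pep_quadratic n N G f \<and>
     pep_coord_smooth n N G f \<and> pep_initial n N \<Delta> G"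

definition pep_val :: "nat \<Rightarrow> nat \<Rightarrow> real \<Rightarrow> real \<Rightarrow> ereal" where
  "pep_val n N L \<Delta> =
     Sup {ereal (f (Iter (pep_steps n N)) - f Star) | G f. pep_feasible n N L \<Delta> G f}"

end

theory Submission
  imports Defs
begin

text \<open>Substituting \<open>y = D\<^sup>1\<^sup>/\<^sup>2 (x - x\<^sup>\<star>)\<close> turns \<open>f(x) - f(x\<^sup>\<star>)\<close> into \<open>y\<^sup>T B y / 2\<close> with
  \<open>B = D\<^sup>-\<^sup>1\<^sup>/\<^sup>2 A D\<^sup>-\<^sup>1\<^sup>/\<^sup>2\<close>, which has unit diagonal and the same eigenvalues as \<open>D\<^sup>-\<^sup>1 A\<close>, and turns each
  Gauss-Seidel update into a coordinate descent step of unit length. Every block of the performance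
  estimation problem is then a single real number, so the iterates and gradients give a feasible
  Gram matrix of rank one. The smoothness constraint amounts to \<open>\<parallel>Bd\<parallel>\<^sup>2 \<le> L d\<^sup>T B d\<close>, which
  follows from \<open>B \<le> L I\<close> and the Cauchy-Schwarz inequality for the form \<open>B\<close>; the coordinate-wise
  constraints hold with equality.\<close>

section \<open>Quadratic forms and largest eigenvalue of positive semidefinite matrices\<close>

lemma scalar_prod_self_nonneg: "0 \<le> (v :: real vec) \<bullet> v"
  by (simp add: scalar_prod_def sum_nonneg)

lemma scalar_prod_self_pos:
  fixes v :: "real vec"
  assumes "v \<in> carrier_vec n" and "v \<noteq> 0\<^sub>v n"
  shows "0 < v \<bullet> v"
  using conjugate_square_greater_0_vec[OF assms(1)] assms by (simp add: conjugate_vec_def vec_eq_iff)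

lemma psd_mat_D:
  assumes "psd_mat n A"
  shows "A \<in> carrier_mat n n" "A\<^sup>T = A" "\<And>v. v \<in> carrier_vec n \<Longrightarrow> 0 \<le> v \<bullet> (A *\<^sub>v v)"
  using assms by (auto simp: psd_mat_def)

lemma symmetric_form_commute:
  fixes A :: "real mat"
  assumes "A \<in> carrier_mat n n" "A\<^sup>T = A" "u \<in> carrier_vec n" "v \<in> carrier_vec n"
  shows "u \<bullet> (A *\<^sub>v v) = v \<bullet> (A *\<^sub>v u)"
  using transpose_vec_mult_scalar[OF assms(1,3,4)] assms
  by (metis comm_scalar_prod mult_mat_vec_carrier)

lemma symmetric_form_diff_smult:
  fixes A :: "real mat"
  assumes "A \<in> carrier_mat n n" "A\<^sup>T = A" "u \<in> carrier_vec n" "v \<in> carrier_vec n"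
  shows "(u - t \<cdot>\<^sub>v v) \<bullet> (A *\<^sub>v (u - t \<cdot>\<^sub>v v)) =
    u \<bullet> (A *\<^sub>v u) - 2 * t * (u \<bullet> (A *\<^sub>v v)) + t\<^sup>2 * (v \<bullet> (A *\<^sub>v v))"
proof -
  have Au: "A *\<^sub>v u \<in> carrier_vec n" and Av: "A *\<^sub>v v \<in> carrier_vec n"
    using assms by auto
  have "A *\<^sub>v (u - t \<cdot>\<^sub>v v) = A *\<^sub>v u - t \<cdot>\<^sub>v (A *\<^sub>v v)"
    using assms by (simp add: mult_minus_distrib_mat_vec[where nc=n] mult_mat_vec[where nc=n])
  moreover have "v \<bullet> (A *\<^sub>v u) = u \<bullet> (A *\<^sub>v v)"
    using assms by (rule_tac symmetric_form_commute[where n=n]) auto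
  ultimately show ?thesis using assms Au Av
    by (simp add: minus_scalar_prod_distrib[where n=n] scalar_prod_minus_distrib[where n=n]
        smult_scalar_prod_distrib[where n=n] scalar_prod_smult_distrib[where n=n]
        power2_eq_square algebra_simps)
qed

text \<open>The form at \<open>u - t v\<close> is a polynomial in \<open>t\<close> of degree at most
  two that is nowhere negative, so its discriminant is not positive.\<close>

lemma psd_form_Cauchy_Schwarz:
  assumes A: "psd_mat n A" and u: "u \<in> carrier_vec n" and v: "v \<in> carrier_vec n"
  shows "(u \<bullet> (A *\<^sub>v v))\<^sup>2 \<le> (u \<bullet> (A *\<^sub>v u)) * (v \<bullet> (A *\<^sub>v v))"
proof -
  define a where "a = u \<bullet> (A *\<^sub>v u)"
  define c where "c = u \<bullet> (A *\<^sub>v v)"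
  define d where "d = v \<bullet> (A *\<^sub>v v)"
  have q: "0 \<le> a - 2 * t * c + t\<^sup>2 * d" for t
    using psd_mat_D(3)[OF A, of "u - t \<cdot>\<^sub>v v"] u v
      symmetric_form_diff_smult[OF psd_mat_D(1,2)[OF A] u v, of t]
    by (simp add: a_def c_def d_def)
  have "0 \<le> d" using psd_mat_D(3)[OF A v] by (simp add: d_def)
  have "c\<^sup>2 \<le> a * d"
  proof (cases "d = 0")
    case True
    have "c = 0"
    proof (rule ccontr)
      assume "c \<noteq> 0"
      \<comment> \<open>With \<open>d = 0\<close> the polynomial is the affine function
        \<open>a - 2 t c\<close>, and this \<open>t\<close> gives it the value
        \<open>-1\<close>.\<close>
      then show False using q[of "(a + 1) / (2 * c)"] True by simp
    qed
    then show ?thesis using True by simp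
  next
    case False
    then have d: "0 < d" using \<open>0 \<le> d\<close> by simp
    \<comment> \<open>The minimizer of the polynomial is \<open>t = c / d\<close>.\<close>
    have "a - 2 * (c / d) * c + (c / d)\<^sup>2 * d = a - c\<^sup>2 / d"
      using d by (simp add: power2_eq_square field_simps)
    then have "c\<^sup>2 / d \<le> a" using q[of "c / d"] by simp
    then show ?thesis using d by (simp add: field_simps)
  qed
  then show ?thesis by (simp add: a_def c_def d_def)
qed

lemma psd_mat_one: "psd_mat n (1\<^sub>m n)"
  by (auto simp: psd_mat_def scalar_prod_self_nonneg)

text \<open>\<open>C\<close> is the squared Frobenius norm: each entry of \<open>A v\<close> pairs a
  row with \<open>v\<close>, and Cauchy-Schwarz for the identity form bounds its square.\<close>

lemma mult_mat_vec_bounded: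
  fixes A :: "real mat"
  assumes A: "A \<in> carrier_mat m n"
  obtains C where "0 \<le> C"
    and "\<And>v. v \<in> carrier_vec n \<Longrightarrow> (A *\<^sub>v v) \<bullet> (A *\<^sub>v v) \<le> C * (v \<bullet> v)"
proof
  let ?C = "\<Sum>i<m. row A i \<bullet> row A i"
  show "0 \<le> ?C" by (intro sum_nonneg scalar_prod_self_nonneg)
  fix v :: "real vec" assume v: "v \<in> carrier_vec n"
  have "(A *\<^sub>v v) \<bullet> (A *\<^sub>v v) = (\<Sum>i<m. (row A i \<bullet> v)\<^sup>2)"
    using A by (simp add: scalar_prod_def[of "A *\<^sub>v v"] power2_eq_square atLeast0LessThan)
  also have "\<dots> \<le> (\<Sum>i<m. (row A i \<bullet> row A i) * (v \<bullet> v))"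
  proof (rule sum_mono)
    fix i assume "i \<in> {..<m}"
    then have "row A i \<in> carrier_vec n" using A by simp
    from psd_form_Cauchy_Schwarz[OF psd_mat_one this v] this v
    show "(row A i \<bullet> v)\<^sup>2 \<le> (row A i \<bullet> row A i) * (v \<bullet> v)" by simp
  qed
  finally show "(A *\<^sub>v v) \<bullet> (A *\<^sub>v v) \<le> ?C * (v \<bullet> v)" by (simp add: sum_distrib_right)
qed

text \<open>Cauchy-Schwarz for the form \<open>A\<close> at \<open>v\<close> and
  \<open>w = A v\<close> gives \<open>|w|^4 \<le> (v . A v) (w . A w)\<close>; bounding the last
  factor by \<open>c |w|^2\<close> lets one \<open>|w|^2\<close> cancel.\<close>

lemma psd_mat_image_bound:
  assumes A: "psd_mat n A" and c: "\<And>v. v \<in> carrier_vec n \<Longrightarrow> v \<bullet> (A *\<^sub>v v) \<le> c * (v \<bullet> v)"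
    and v: "v \<in> carrier_vec n"
  shows "(A *\<^sub>v v) \<bullet> (A *\<^sub>v v) \<le> c * (v \<bullet> (A *\<^sub>v v))"
proof -
  define w where "w = A *\<^sub>v v"
  have w: "w \<in> carrier_vec n" using psd_mat_D(1)[OF A] v by (simp add: w_def)
  have "w \<bullet> w = v \<bullet> (A *\<^sub>v w)"
    using symmetric_form_commute[OF psd_mat_D(1,2)[OF A] w v] by (simp add: w_def)
  then have "(w \<bullet> w)\<^sup>2 \<le> (v \<bullet> w) * (w \<bullet> (A *\<^sub>v w))"
    using psd_form_Cauchy_Schwarz[OF A v w] by (simp add: w_def)
  also have "\<dots> \<le> (v \<bullet> w) * (c * (w \<bullet> w))"
    using c[OF w] psd_mat_D(3)[OF A v] by (intro mult_left_mono) (auto simp: w_def)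
  finally have sq: "(w \<bullet> w) * (w \<bullet> w) \<le> (c * (v \<bullet> w)) * (w \<bullet> w)"
    by (simp add: power2_eq_square ac_simps)
  show ?thesis
  proof (cases "w = 0\<^sub>v n")
    case True
    then show ?thesis using v by (simp flip: w_def)
  next
    case False
    then show ?thesis using sq scalar_prod_self_pos[OF w False] by (simp flip: w_def)
  qed
qed

text \<open>No compactness is needed: for the least \<open>\<mu>\<close> with \<open>\<mu>I - B\<close> positive semidefinite, this matrix
  is singular, since an invertible positive semidefinite matrix dominates a positive multiple of
  the identity.\<close>

lemma psd_mat_max_eigenvalue:
  assumes B: "psd_mat n B" and n: "n \<ge> 1"
  obtains \<mu> where "eigenvalue B \<mu>"
    and "\<And>v. v \<in> carrier_vec n \<Longrightarrow> v \<bullet> (B *\<^sub>v v) \<le> \<mu> * (v \<bullet> v)"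
proof -
  note Bc = psd_mat_D(1)[OF B]
  define S where "S = {c. \<forall>v\<in>carrier_vec n. v \<bullet> (B *\<^sub>v v) \<le> c * (v \<bullet> v)}"
  define \<mu> where "\<mu> = Inf S"
  have low: "v \<bullet> (B *\<^sub>v v) / (v \<bullet> v) \<le> c"
    if "c \<in> S" "v \<in> carrier_vec n" "v \<noteq> 0\<^sub>v n" for c v
    using that scalar_prod_self_pos[OF that(2,3)] by (simp add: S_def pos_divide_le_eq)
  \<comment> \<open>Since \<open>n \<ge> 1\<close>, a nonzero test vector exists; its Rayleigh
    quotient is nonnegative and bounds \<open>S\<close> from below.\<close>
  have u: "unit_vec n 0 \<in> carrier_vec n" "unit_vec n 0 \<noteq> (0\<^sub>v n :: real vec)"
    using n by (auto simp: vec_eq_iff intro!: exI[of _ 0])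
  have S_nonneg: "0 \<le> c" if "c \<in> S" for c
    using low[OF that u] psd_mat_D(3)[OF B u(1)] scalar_prod_self_pos[OF u]
    by (meson divide_nonneg_pos order_trans)
  have bdd: "bdd_below S" using S_nonneg by (auto simp: bdd_below_def)
  obtain C where C: "0 \<le> C" "\<And>v. v \<in> carrier_vec n \<Longrightarrow> (B *\<^sub>v v) \<bullet> (B *\<^sub>v v) \<le> C * (v \<bullet> v)"
    using mult_mat_vec_bounded[OF Bc] by blast
  \<comment> \<open>Expanding \<open>0 \<le> |v - B v|^2\<close> bounds \<open>2 (v . B v)\<close>
    by \<open>|v|^2 + |B v|^2\<close>, which is at most \<open>(1 + C) |v|^2\<close>.\<close>
  have "(1 + C) / 2 \<in> S" unfolding S_def
  proof safe
    fix v :: "real vec" assume v: "v \<in> carrier_vec n"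
    then have w: "B *\<^sub>v v \<in> carrier_vec n" using Bc by simp
    have "0 \<le> v \<bullet> v - 2 * (v \<bullet> (B *\<^sub>v v)) + (B *\<^sub>v v) \<bullet> (B *\<^sub>v v)"
      using symmetric_form_diff_smult[of "1\<^sub>m n" n v "B *\<^sub>v v" 1] v w
        scalar_prod_self_nonneg[of "v - B *\<^sub>v v"] by simp
    then show "v \<bullet> (B *\<^sub>v v) \<le> (1 + C) / 2 * (v \<bullet> v)"
      using C(2)[OF v] by (simp add: field_simps)
  qed
  then have ne: "S \<noteq> {}" by auto
  \<comment> \<open>The infimum belongs to \<open>S\<close>: for nonzero \<open>v\<close> the
    Rayleigh quotient is a lower bound of \<open>S\<close>, hence at most
    \<open>Inf S\<close>.\<close>
  have \<mu>: "v \<bullet> (B *\<^sub>v v) \<le> \<mu> * (v \<bullet> v)" if v: "v \<in> carrier_vec n" for v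
  proof (cases "v = 0\<^sub>v n")
    case True
    then show ?thesis using Bc by simp
  next
    case False
    have "v \<bullet> (B *\<^sub>v v) / (v \<bullet> v) \<le> \<mu>"
      unfolding \<mu>_def using low[OF _ v False] ne by (intro cInf_greatest) auto
    then show ?thesis using scalar_prod_self_pos[OF v False] by (simp add: pos_divide_le_eq)
  qed
  have \<mu>0: "0 \<le> \<mu>" unfolding \<mu>_def using S_nonneg ne by (intro cInf_greatest) auto
  define M where "M = \<mu> \<cdot>\<^sub>m 1\<^sub>m n - B"
  have Mc: "M \<in> carrier_mat n n" using Bc unfolding M_def by (rule minus_carrier_mat)
  have Mv: "M *\<^sub>v v = \<mu> \<cdot>\<^sub>v v - B *\<^sub>v v" if v: "v \<in> carrier_vec n" for v
  proof -
    have "(\<mu> \<cdot>\<^sub>m 1\<^sub>m n) *\<^sub>v v = \<mu> \<cdot>\<^sub>v v"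
      using v by (intro eq_vecI) (auto simp: row_smult)
    then show ?thesis using v Bc by (simp add: M_def minus_mult_distrib_mat_vec[where nr=n and nc=n])
  qed
  have form: "v \<bullet> (M *\<^sub>v v) = \<mu> * (v \<bullet> v) - v \<bullet> (B *\<^sub>v v)" if v: "v \<in> carrier_vec n" for v
    using v Bc by (simp add: Mv scalar_prod_minus_distrib[where n=n])
  have MT: "M\<^sup>T = M"
    using Bc psd_mat_D(2)[OF B] unfolding M_def
    by (auto simp: mat_eq_iff)
  have M: "psd_mat n M" using Mc MT form \<mu> by (simp add: psd_mat_def)
  have "det M = 0"
  proof (rule ccontr)
    assume "det M \<noteq> 0"
    from det_non_zero_imp_unit[OF Mc this]
    obtain W where W: "W \<in> carrier_mat n n" "W * M = 1\<^sub>m n"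
      by (auto simp: Units_def ring_mat_def)
    obtain K where K: "0 \<le> K" "\<And>v. v \<in> carrier_vec n \<Longrightarrow> (W *\<^sub>v v) \<bullet> (W *\<^sub>v v) \<le> K * (v \<bullet> v)"
      using mult_mat_vec_bounded[OF W(1)] by blast
    \<comment> \<open>Chosen so that \<open>e |v|^2 \<le> v . M v\<close>, which lets
      \<open>\<mu>\<close> be lowered by \<open>e\<close>; the summand \<open>1\<close> keeps the
      denominator positive when \<open>K * \<mu>\<close> is zero.\<close>
    define e where "e = 1 / (K * \<mu> + 1)"
    have e: "e > 0" using K \<mu>0 by (simp add: e_def add_nonneg_pos)
    have "\<mu> - e \<in> S" unfolding S_def
    proof safe
      fix v :: "real vec" assume v: "v \<in> carrier_vec n"
      have Mvc: "M *\<^sub>v v \<in> carrier_vec n" using Mc v by simp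
      have "v = W *\<^sub>v (M *\<^sub>v v)"
        using W v Mc by (simp flip: assoc_mult_mat_vec[where n\<^sub>1=n and n\<^sub>2=n and n\<^sub>3=n])
      then have "v \<bullet> v \<le> K * ((M *\<^sub>v v) \<bullet> (M *\<^sub>v v))" using K(2)[OF Mvc] by simp
      also have "\<dots> \<le> K * (\<mu> * (v \<bullet> (M *\<^sub>v v)))"
      proof (rule mult_left_mono[OF psd_mat_image_bound[OF M _ v] K(1)])
        \<comment> \<open>\<open>M\<close> is at most \<open>\<mu> I\<close> because
          \<open>B\<close> is positive semidefinite.\<close>
        fix u :: "real vec" assume "u \<in> carrier_vec n"
        then show "u \<bullet> (M *\<^sub>v u) \<le> \<mu> * (u \<bullet> u)" using form psd_mat_D(3)[OF B] by simp
      qed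
      also have "\<dots> \<le> (K * \<mu> + 1) * (v \<bullet> (M *\<^sub>v v))"
        using psd_mat_D(3)[OF M v] by (simp add: algebra_simps)
      finally have "e * (v \<bullet> v) \<le> v \<bullet> (M *\<^sub>v v)"
        using K \<mu>0 by (simp add: e_def pos_divide_le_eq add_nonneg_pos mult.commute)
      then show "v \<bullet> (B *\<^sub>v v) \<le> (\<mu> - e) * (v \<bullet> v)"
        using form[OF v] by (simp add: algebra_simps)
    qed
    then have "\<mu> \<le> \<mu> - e" unfolding \<mu>_def using bdd by (intro cInf_lower)
    then show False using e by simp
  qed
  then obtain v where v: "v \<in> carrier_vec n" "v \<noteq> 0\<^sub>v n" "M *\<^sub>v v = 0\<^sub>v n"
    using det_0_iff_vec_prod_zero[OF Mc] by blast
  have "B *\<^sub>v v = \<mu> \<cdot>\<^sub>v v"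
    using v(3) Mv[OF v(1)] v(1) Bc by (auto simp: vec_eq_iff)
  then have "eigenvalue B \<mu>" using v Bc by (auto simp: eigenvalue_def eigenvector_def)
  with \<mu> show ?thesis using that by blast
qed

section \<open>Second-order expansion and rank-one Gram matrices\<close>

lemma mult_mat_vec_index_sum:
  assumes "A \<in> carrier_mat n m" "v \<in> carrier_vec m" "i < n"
  shows "(A *\<^sub>v v) $ i = (\<Sum>j<m. A $$ (i, j) * v $ j)"
  using assms by (simp add: scalar_prod_def atLeast0LessThan)

text \<open>Taylor expansion of the quadratic at \<open>w\<close>, with gradient \<open>B w\<close>
  and an exact second-order term. It gives the differences of function values in the constraints and
  in the final passage to \<open>quad_fun\<close>.\<close>

lemma quadratic_form_expand:
  fixes B :: "real mat"
  assumes "B \<in> carrier_mat n n" "B\<^sup>T = B" and u: "u \<in> carrier_vec n" and w: "w \<in> carrier_vec n"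
  shows "1 / 2 * (u \<bullet> (B *\<^sub>v u)) = 1 / 2 * (w \<bullet> (B *\<^sub>v w)) + (B *\<^sub>v w) \<bullet> (u - w)
    + 1 / 2 * ((u - w) \<bullet> (B *\<^sub>v (u - w)))"
proof -
  have Bw: "B *\<^sub>v w \<in> carrier_vec n" using assms by auto
  have c: "(B *\<^sub>v w) \<bullet> u = u \<bullet> (B *\<^sub>v w)" "(B *\<^sub>v w) \<bullet> w = w \<bullet> (B *\<^sub>v w)"
    using comm_scalar_prod Bw u w by blast+
  have "(B *\<^sub>v w) \<bullet> (u - w) = u \<bullet> (B *\<^sub>v w) - w \<bullet> (B *\<^sub>v w)"
    using c Bw u w by (simp add: scalar_prod_minus_distrib[where n=n])
  then show ?thesis
    using symmetric_form_diff_smult[OF assms, of 1] by (simp add: algebra_simps)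
qed

text \<open>The matrix \<open>w w^T\<close>. As a Gram matrix it makes each label vector
  \<open>u\<close> stand for the single real number \<open>u . w\<close>.\<close>

definition rank_one_mat :: "real vec \<Rightarrow> real mat" where
  "rank_one_mat w = mat (dim_vec w) (dim_vec w) (\<lambda>(i, j). w $ i * w $ j)"

lemma inner_G_rank_one:
  assumes "w \<in> carrier_vec p" "u \<in> carrier_vec p" "v \<in> carrier_vec p"
  shows "inner_G (rank_one_mat w) u v = (u \<bullet> w) * (v \<bullet> w)"
proof -
  have "rank_one_mat w *\<^sub>v v = (v \<bullet> w) \<cdot>\<^sub>v w"
    using assms by (intro eq_vecI)
      (auto simp: rank_one_mat_def scalar_prod_def sum_distrib_left ac_simps intro!: sum.cong)
  then show ?thesis using assms by (simp add: inner_G_def)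
qed

lemma psd_rank_one:
  assumes "w \<in> carrier_vec p"
  shows "psd_mat p (rank_one_mat w)"
  unfolding psd_mat_def
proof (intro conjI ballI)
  show "rank_one_mat w \<in> carrier_mat p p" using assms by (simp add: rank_one_mat_def)
  show "(rank_one_mat w)\<^sup>T = rank_one_mat w"
    by (intro eq_matI) (auto simp: rank_one_mat_def)
  fix v :: "real vec" assume "v \<in> carrier_vec p"
  then show "0 \<le> v \<bullet> (rank_one_mat w *\<^sub>v v)"
    using inner_G_rank_one[OF assms, of v v] by (simp add: inner_G_def)
qed

text \<open>Stores at each position the number that the unit vector there is to represent. Quotient
  and remainder by \<open>n\<close> invert the labelling \<open>n + k * n + i\<close>.\<close>

definition pep_gram_vec :: "nat \<Rightarrow> nat \<Rightarrow> (nat \<Rightarrow> real vec) \<Rightarrow> (nat \<Rightarrow> real vec) \<Rightarrow> real vec" where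
  "pep_gram_vec n N y g = vec (pep_dim n N)
     (\<lambda>m. if m < n then y 0 $ m else g ((m - n) div n) $ ((m - n) mod n))"

lemma pep_gram_vec_carrier: "pep_gram_vec n N y g \<in> carrier_vec (pep_dim n N)"
  by (simp add: pep_gram_vec_def)

lemma grad_iter_gram:
  assumes "k \<le> pep_steps n N" "i < n"
  shows "grad_iter n N k i \<bullet> pep_gram_vec n N y g = g k $ i"
proof -
  have "n + k * n + i < n + (k + 1) * n" using assms by simp
  \<comment> \<open>The index \<open>k\<close> may equal \<open>pep_steps n N\<close>; the
    \<open>+ 1\<close> in \<open>pep_dim\<close> leaves room for the gradient at the last
    point.\<close>
  also have "\<dots> \<le> pep_dim n N"
    using mult_le_mono1[of "k + 1" "pep_steps n N + 1" n] assms
    by (simp add: pep_dim_def ac_simps)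
  finally have "n + k * n + i < pep_dim n N" .
  then show ?thesis using assms
    by (simp add: grad_iter_def scalar_prod_left_unit[OF pep_gram_vec_carrier])
       (simp add: pep_gram_vec_def add.assoc)
qed

lemma point_iter_carrier: "point_iter n N k i \<in> carrier_vec (pep_dim n N)"
  by (induction k) (auto simp: grad_iter_def)

text \<open>Pairing with the Gram vector is linear, so the recursion of \<open>point_iter\<close>
  turns into the coordinate step satisfied by \<open>y\<close>; the induction starts from the stored
  \<open>y 0\<close>.\<close>

lemma point_iter_gram:
  assumes step: "\<And>k i. k < pep_steps n N \<Longrightarrow> i < n \<Longrightarrow>
      y (Suc k) $ i = (if i = k mod n then y k $ i - g k $ i else y k $ i)"
    and "k \<le> pep_steps n N" "i < n"
  shows "point_iter n N k i \<bullet> pep_gram_vec n N y g = y k $ i"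
  using assms(2)
proof (induction k)
  case 0
  have "i < pep_dim n N" using assms(3) by (simp add: pep_dim_def)
  then show ?case using assms(3)
    by (simp add: scalar_prod_left_unit[OF pep_gram_vec_carrier]) (simp add: pep_gram_vec_def)
next
  case (Suc k)
  have "grad_iter n N k i \<in> carrier_vec (pep_dim n N)" by (simp add: grad_iter_def)
  then show ?case using Suc step[of k i] assms(3) grad_iter_gram[of k n N i y g]
    by (auto simp: minus_scalar_prod_distrib[OF point_iter_carrier _ pep_gram_vec_carrier])
qed

section \<open>Feasibility of coordinate descent trajectories\<close>

text \<open>The trajectory, its gradients \<open>B y\<close> and its function values form a feasible
  point of the problem, so its objective lies below the supremum.\<close>

lemma coordinate_descent_le_pep_val:
  assumes B: "psd_mat n B" and diag: "\<And>i. i < n \<Longrightarrow> B $$ (i, i) = 1"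
    and L: "\<And>v. v \<in> carrier_vec n \<Longrightarrow> v \<bullet> (B *\<^sub>v v) \<le> L * (v \<bullet> v)"
    and y: "\<And>k. y k \<in> carrier_vec n"
    and step: "\<And>k i. k < pep_steps n N \<Longrightarrow> i < n \<Longrightarrow>
      y (Suc k) $ i = (if i = k mod n then y k $ i - (B *\<^sub>v y k) $ i else y k $ i)"
    and init: "y 0 \<bullet> y 0 \<le> \<Delta>"
  shows "ereal (1 / 2 * (y (pep_steps n N) \<bullet> (B *\<^sub>v y (pep_steps n N)))) \<le> pep_val n N L \<Delta>"
proof -
  note Bc = psd_mat_D(1)[OF B]
  define w where "w = pep_gram_vec n N y (\<lambda>k. B *\<^sub>v y k)"
  define G where "G = rank_one_mat w"
  \<comment> \<open>The minimizer sits at the origin: \<open>Star\<close> receives the zero vector,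
    with zero gradient and function value \<open>0\<close>.\<close>
  define X where "X = (\<lambda>r. case r of Iter k \<Rightarrow> y k | Star \<Rightarrow> 0\<^sub>v n)"
  define f where "f = (\<lambda>r. 1 / 2 * (X r \<bullet> (B *\<^sub>v X r)))"
  have w: "w \<in> carrier_vec (pep_dim n N)" by (simp add: w_def pep_gram_vec_carrier)
  have X: "X r \<in> carrier_vec n" for r using y by (cases r) (auto simp: X_def)
  have BX: "B *\<^sub>v X r \<in> carrier_vec n" for r using X Bc by simp
  have carr: "pep_x n N r i \<in> carrier_vec (pep_dim n N)" "pep_g n N r i \<in> carrier_vec (pep_dim n N)"
    for r i by (cases r; simp add: point_iter_carrier grad_iter_def)+
  \<comment> \<open>From here on every inner product of the problem is a product of real numbers:
    labels pair with \<open>w\<close> to coordinates of \<open>X r\<close> and of its gradient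
    \<open>B X r\<close>.\<close>
  have xw: "pep_x n N r i \<bullet> w = X r $ i" if "r \<in> pep_indices n N" "i < n" for r i
    using that w point_iter_gram[of n N y "\<lambda>k. B *\<^sub>v y k", OF step]
    by (auto simp: pep_indices_def X_def w_def)
  have B0: "B *\<^sub>v 0\<^sub>v n = 0\<^sub>v n" using Bc by (intro eq_vecI) auto
  have gw: "pep_g n N r i \<bullet> w = (B *\<^sub>v X r) $ i" if "r \<in> pep_indices n N" "i < n" for r i
    using that w grad_iter_gram[of _ n N i y "\<lambda>k. B *\<^sub>v y k"] B0
    by (auto simp: pep_indices_def X_def w_def simp del: index_mult_mat_vec)
  have xd: "(pep_x n N r i - pep_x n N s i) \<bullet> w = (X r - X s) $ i"
    if "r \<in> pep_indices n N" "s \<in> pep_indices n N" "i < n" for r s i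
    using that X[of s] by (simp add: minus_scalar_prod_distrib[OF carr(1) carr(1) w] xw)
  have gd: "(pep_g n N r i - pep_g n N s i) \<bullet> w = (B *\<^sub>v (X r - X s)) $ i"
    if "r \<in> pep_indices n N" "s \<in> pep_indices n N" "i < n" for r s i
    using that BX[of s] Bc by (simp add: minus_scalar_prod_distrib[OF carr(2) carr(2) w] gw
       mult_minus_distrib_mat_vec[OF Bc X X] del: index_mult_mat_vec)
  note inner = inner_G_rank_one[OF w, folded G_def]
  have sum_dot: "(\<Sum>i<n. u $ i * v $ i) = u \<bullet> v" if "v \<in> carrier_vec n" for u v :: "real vec"
    using that by (simp add: scalar_prod_def atLeast0LessThan)
  have lin: "(\<Sum>i<n. inner_G G (pep_g n N s i) (pep_x n N r i - pep_x n N s i)) =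
      (B *\<^sub>v X s) \<bullet> (X r - X s)"
    if "r \<in> pep_indices n N" "s \<in> pep_indices n N" for r s
  proof -
    have "(\<Sum>i<n. inner_G G (pep_g n N s i) (pep_x n N r i - pep_x n N s i)) =
      (\<Sum>i<n. (B *\<^sub>v X s) $ i * (X r - X s) $ i)"
      using that carr by (intro sum.cong refl) (simp only: inner minus_carrier_vec xd gw lessThan_iff)
    then show ?thesis using X by (simp only: sum_dot minus_carrier_vec)
  qed
  have quad: "f r = f s + (B *\<^sub>v X s) \<bullet> (X r - X s) + 1 / 2 * ((X r - X s) \<bullet> (B *\<^sub>v (X r - X s)))"
    for r s unfolding f_def using quadratic_form_expand[OF psd_mat_D(1,2)[OF B] X X] .
  have "pep_smooth n N L G f" unfolding pep_smooth_def
  proof safe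
    fix r s assume rs: "r \<in> pep_indices n N" "s \<in> pep_indices n N"
    define d where "d = X r - X s"
    have d: "d \<in> carrier_vec n" using X by (simp add: d_def)
    have Bd: "B *\<^sub>v d \<in> carrier_vec n" using d Bc by simp
    have "(\<Sum>i<n. inner_G G (pep_g n N r i - pep_g n N s i) (pep_g n N r i - pep_g n N s i)) =
      (\<Sum>i<n. (B *\<^sub>v d) $ i * (B *\<^sub>v d) $ i)"
      using rs carr by (intro sum.cong refl) (simp only: inner minus_carrier_vec gd lessThan_iff d_def)
    then have gg: "(\<Sum>i<n. inner_G G (pep_g n N r i - pep_g n N s i) (pep_g n N r i - pep_g n N s i)) =
      (B *\<^sub>v d) \<bullet> (B *\<^sub>v d)" using Bd by (simp only: sum_dot)
    \<comment> \<open>This is the constraint once \<open>quad\<close> has cancelled the linear part.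
      For \<open>L > 0\<close> it is the image bound; otherwise \<open>1 / (2 * L)\<close> is
      nonpositive, with \<open>1 / 0 = 0\<close>, and so is the left side.\<close>
    have "1 / (2 * L) * ((B *\<^sub>v d) \<bullet> (B *\<^sub>v d)) \<le> 1 / 2 * (d \<bullet> (B *\<^sub>v d))"
    proof (cases "L > 0")
      case True
      then show ?thesis using psd_mat_image_bound[OF B L d] by (simp add: field_simps)
    next
      case False
      then have "1 / (2 * L) * ((B *\<^sub>v d) \<bullet> (B *\<^sub>v d)) \<le> 0"
        by (intro mult_nonpos_nonneg scalar_prod_self_nonneg) simp
      then show ?thesis using psd_mat_D(3)[OF B d] by linarith
    qed
    then show "f s + (\<Sum>i<n. inner_G G (pep_g n N s i) (pep_x n N r i - pep_x n N s i))
        + 1 / (2 * L) *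
          (\<Sum>i<n. inner_G G (pep_g n N r i - pep_g n N s i) (pep_g n N r i - pep_g n N s i)) \<le> f r"
      unfolding gg lin[OF rs] quad[of r s] d_def by simp
  qed
  moreover have "pep_quadratic n N G f" unfolding pep_quadratic_def
  proof safe
    fix r s assume rs: "r \<in> pep_indices n N" "s \<in> pep_indices n N"
    define d where "d = X r - X s"
    have d: "d \<in> carrier_vec n" using X by (simp add: d_def)
    have "(\<Sum>i<n. inner_G G (pep_g n N r i - pep_g n N s i) (pep_x n N r i - pep_x n N s i)) =
      (\<Sum>i<n. (B *\<^sub>v d) $ i * d $ i)"
      using rs carr
      by (intro sum.cong refl) (simp only: inner minus_carrier_vec gd xd lessThan_iff d_def)
    also have "\<dots> = d \<bullet> (B *\<^sub>v d)"
      using d Bc by (simp only: sum_dot comm_scalar_prod[of "B *\<^sub>v d" n d] mult_mat_vec_carrier)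
    finally show "1 / 2 * (\<Sum>i<n. inner_G G (pep_g n N r i - pep_g n N s i) (pep_x n N r i - pep_x n N s i))
        = f r - f s - (\<Sum>i<n. inner_G G (pep_g n N s i) (pep_x n N r i - pep_x n N s i))"
      unfolding lin[OF rs] quad[of r s] d_def by simp
  qed
  moreover have "pep_coord_smooth n N G f" unfolding pep_coord_smooth_def
  proof (intro allI impI)
    fix k assume k: "k < pep_steps n N"
    define i where "i = k mod n"
    have "n > 0" using k by (cases n) (auto simp: pep_steps_def)
    then have i: "i < n" by (simp add: i_def)
    \<comment> \<open>The unit diagonal makes the \<open>i\<close>-th gradient entry change by the
      same \<open>c\<close> as the point, so the curvature term and the squared gradient difference
      are both \<open>c * c\<close>. Opposite signs of \<open>c\<close> give the two
      directions.\<close>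
    have coord: "coord_smooth_ineq n N G f i r s"
      if rs: "r \<in> pep_indices n N" "s \<in> pep_indices n N" and d: "X r - X s = c \<cdot>\<^sub>v unit_vec n i"
      for r s c
    proof -
      have "B *\<^sub>v unit_vec n i = col B i"
        using Bc i by (intro eq_vecI) auto
      then have Bd: "B *\<^sub>v (X r - X s) = c \<cdot>\<^sub>v col B i"
        unfolding d using Bc by (simp add: mult_mat_vec[where nr=n and nc=n])
      have gdi: "(B *\<^sub>v (X r - X s)) $ i = c" unfolding Bd using Bc i diag by simp
      have xdi: "(X r - X s) $ i = c" unfolding d using i by simp
      have "(X r - X s) \<bullet> (B *\<^sub>v (X r - X s)) = c * c"
        unfolding Bd unfolding d using Bc i diag
        by (simp add: scalar_prod_left_unit[where n=n])
      moreover have "(B *\<^sub>v X s) \<bullet> (X r - X s) = (B *\<^sub>v X s) $ i * c"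
        unfolding d using BX[of s] i by (simp del: index_mult_mat_vec)
      ultimately have "f r = f s + (B *\<^sub>v X s) $ i * c + 1 / 2 * (c * c)"
        using quad[of r s] by simp
      then show ?thesis unfolding coord_smooth_ineq_def
        using rs i carr by (simp only: inner minus_carrier_vec gd xd gw gdi xdi)
    qed
    have idx: "Iter k \<in> pep_indices n N" "Iter (Suc k) \<in> pep_indices n N"
      using k by (auto simp: pep_indices_def)
    have "y k $ j - y (Suc k) $ j = (B *\<^sub>v y k) $ i * unit_vec n i $ j" if "j < n" for j
      using step[OF k that] that i by (auto simp: i_def simp del: index_mult_mat_vec)
    then have "X (Iter k) - X (Iter (Suc k)) = (B *\<^sub>v y k) $ i \<cdot>\<^sub>v unit_vec n i"
      and "X (Iter (Suc k)) - X (Iter k) = (- (B *\<^sub>v y k) $ i) \<cdot>\<^sub>v unit_vec n i"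
      by (auto simp: X_def vec_eq_iff carrier_vecD[OF y] algebra_simps simp del: index_mult_mat_vec)
    then show "coord_smooth_ineq n N G f (k mod n) (Iter k) (Iter (Suc k)) \<and>
        coord_smooth_ineq n N G f (k mod n) (Iter (Suc k)) (Iter k)"
      using coord idx unfolding i_def by blast
  qed
  moreover have "pep_initial n N \<Delta> G"
  proof -
    have 0: "Iter 0 \<in> pep_indices n N" by (simp add: pep_indices_def)
    have "(\<Sum>i<n. inner_G G (pep_x n N (Iter 0) i) (pep_x n N (Iter 0) i)) = (\<Sum>i<n. y 0 $ i * y 0 $ i)"
      using 0 carr by (intro sum.cong refl) (simp only: inner xw lessThan_iff, simp add: X_def)
    then show ?thesis unfolding pep_initial_def using init y by (simp only: sum_dot)
  qed
  ultimately have "pep_feasible n N L \<Delta> G f"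
    unfolding pep_feasible_def G_def using psd_rank_one[OF w] by blast
  then have "ereal (f (Iter (pep_steps n N)) - f Star) \<le> pep_val n N L \<Delta>"
    unfolding pep_val_def by (intro Sup_upper) blast
  moreover have "f Star = 0" using Bc by (simp add: f_def X_def)
  ultimately show ?thesis by (simp add: f_def X_def)
qed

section \<open>Diagonal scaling and the spectrum of \<open>D^-1 A\<close>\<close>

text \<open>\<open>mat_inverse\<close> returns an option: the explicit two-sided inverse excludes
  \<open>None\<close>, and uniqueness of inverses identifies the result.\<close>

lemma mat_inverse_diag_part:
  assumes A: "A \<in> carrier_mat n n" and pos: "\<And>i. i < n \<Longrightarrow> A $$ (i, i) > 0"
  shows "the (mat_inverse (diag_part A)) = mat_diag n (\<lambda>i. 1 / A $$ (i, i))"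
proof -
  let ?D = "diag_part A" and ?E = "mat_diag n (\<lambda>i. 1 / A $$ (i, i))"
  have D: "?D = mat_diag n (\<lambda>i. A $$ (i, i))" using A by (simp add: diag_part_def)
  have Dc: "?D \<in> carrier_mat n n" and Ec: "?E \<in> carrier_mat n n" by (simp_all add: D)
  have DE: "?D * ?E = 1\<^sub>m n" and ED: "?E * ?D = 1\<^sub>m n"
    unfolding D mat_diag_diag using pos
    by (auto simp: mat_diag_def mat_eq_iff less_imp_neq[symmetric])
  have "?D \<in> Units (ring_mat TYPE(real) n ())"
    using Dc Ec DE ED by (auto simp: Units_def ring_mat_def)
  then obtain W where W: "mat_inverse ?D = Some W"
    using mat_inverse(1)[OF Dc] by fastforce
  from mat_inverse(2)[OF Dc W] have W': "W * ?D = 1\<^sub>m n" "W \<in> carrier_mat n n" by auto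
  have "W = W * (?D * ?E)" using W' by (simp add: DE)
  also have "\<dots> = ?E"
    using assoc_mult_mat[OF W'(2) Dc Ec] W'(1) left_mult_one_mat[OF Ec] by simp
  finally show ?thesis using W by simp
qed

text \<open>The matrix \<open>D^(-1/2) A D^(-1/2)\<close>, with \<open>D\<close> the diagonal part
  of \<open>A\<close>.\<close>

definition diag_scaled :: "real mat \<Rightarrow> real mat" where
  "diag_scaled A = mat (dim_row A) (dim_col A)
     (\<lambda>(i, j). A $$ (i, j) / (sqrt (A $$ (i, i)) * sqrt (A $$ (j, j))))"

text \<open>Multiplication by \<open>D^(-1/2)\<close>, which takes the scaled variable back to a
  difference of original points.\<close>

definition diag_unscale :: "real mat \<Rightarrow> real vec \<Rightarrow> real vec" where
  "diag_unscale A v = vec (dim_vec v) (\<lambda>i. v $ i / sqrt (A $$ (i, i)))"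

lemma diag_scaled_carrier: "A \<in> carrier_mat n n \<Longrightarrow> diag_scaled A \<in> carrier_mat n n"
  by (auto simp: diag_scaled_def)

lemma diag_unscale_carrier: "v \<in> carrier_vec n \<Longrightarrow> diag_unscale A v \<in> carrier_vec n"
  by (auto simp: diag_unscale_def)

lemma diag_scaled_mult_vec:
  assumes A: "A \<in> carrier_mat n n" and v: "v \<in> carrier_vec n" and i: "i < n"
  shows "(diag_scaled A *\<^sub>v v) $ i = (A *\<^sub>v diag_unscale A v) $ i / sqrt (A $$ (i, i))"
  using assms unfolding mult_mat_vec_index_sum[OF diag_scaled_carrier[OF A] v i]
    mult_mat_vec_index_sum[OF A diag_unscale_carrier[OF v] i]
  by (simp add: diag_scaled_def diag_unscale_def sum_divide_distrib ac_simps)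

lemma diag_scaled_form:
  assumes A: "A \<in> carrier_mat n n" and v: "v \<in> carrier_vec n"
  shows "v \<bullet> (diag_scaled A *\<^sub>v v) = diag_unscale A v \<bullet> (A *\<^sub>v diag_unscale A v)"
proof -
  have "v \<bullet> (diag_scaled A *\<^sub>v v) = (\<Sum>i<n. v $ i * (diag_scaled A *\<^sub>v v) $ i)"
    using diag_scaled_carrier[OF A] by (simp add: scalar_prod_def atLeast0LessThan)
  also have "\<dots> = (\<Sum>i<n. diag_unscale A v $ i * (A *\<^sub>v diag_unscale A v) $ i)"
    using v by (intro sum.cong refl)
      (simp add: diag_scaled_mult_vec[OF A v] diag_unscale_def del: index_mult_mat_vec)
  finally show ?thesis using A by (simp add: scalar_prod_def atLeast0LessThan)
qed

lemma psd_diag_scaled: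
  assumes "psd_mat n A"
  shows "psd_mat n (diag_scaled A)"
  unfolding psd_mat_def
proof (intro conjI ballI)
  note A = psd_mat_D[OF assms]
  show "diag_scaled A \<in> carrier_mat n n" using A(1) by (rule diag_scaled_carrier)
  have "A $$ (j, i) = A $$ (i, j)" if "i < n" "j < n" for i j
    using A(1,2) that by (metis carrier_matD index_transpose_mat(1))
  then show "(diag_scaled A)\<^sup>T = diag_scaled A"
    using A(1) by (intro eq_matI) (auto simp: diag_scaled_def ac_simps)
  fix v :: "real vec" assume "v \<in> carrier_vec n"
  then show "0 \<le> v \<bullet> (diag_scaled A *\<^sub>v v)"
    using A(3) by (simp add: diag_scaled_form[OF A(1)] diag_unscale_carrier)
qed

text \<open>With \<open>B = diag_scaled A\<close>, the matrix
  \<open>D^-1 A = D^(-1/2) B D^(1/2)\<close> is similar to \<open>B\<close>, and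
  \<open>D^(-1/2)\<close> carries eigenvectors of \<open>B\<close> to eigenvectors of
  \<open>D^-1 A\<close>.\<close>

lemma eigenvalue_diag_scaled:
  assumes A: "A \<in> carrier_mat n n" and pos: "\<And>i. i < n \<Longrightarrow> A $$ (i, i) > 0"
    and ev: "eigenvalue (diag_scaled A) \<mu>"
  shows "eigenvalue (mat_diag n (\<lambda>i. 1 / A $$ (i, i)) * A) \<mu>"
proof -
  obtain v where v: "v \<in> carrier_vec n" "v \<noteq> 0\<^sub>v n" "diag_scaled A *\<^sub>v v = \<mu> \<cdot>\<^sub>v v"
    using ev diag_scaled_carrier[OF A] by (auto simp: eigenvalue_def eigenvector_def)
  define u where "u = diag_unscale A v"
  let ?E = "mat_diag n (\<lambda>i. 1 / A $$ (i, i))"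
  have u: "u \<in> carrier_vec n" using v by (simp add: u_def diag_unscale_carrier)
  have ui: "u $ i = v $ i / sqrt (A $$ (i, i))" if "i < n" for i
    using that v by (simp add: u_def diag_unscale_def)
  obtain i where "i < n" "v $ i \<noteq> 0" using v by (auto simp: vec_eq_iff)
  then have "u $ i \<noteq> 0" using ui pos[of i] by simp
  then have "u \<noteq> 0\<^sub>v n" using \<open>i < n\<close> by auto
  moreover have "(?E * A) *\<^sub>v u = \<mu> \<cdot>\<^sub>v u"
  proof (rule eq_vecI)
    fix i assume "i < dim_vec (\<mu> \<cdot>\<^sub>v u)"
    then have i: "i < n" using u by simp
    have EA: "?E * A \<in> carrier_mat n n" using A by (simp add: mult_carrier_mat[where n=n])
    have s: "sqrt (A $$ (i, i)) * sqrt (A $$ (i, i)) = A $$ (i, i)" "sqrt (A $$ (i, i)) > 0"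
      using pos[OF i] by auto
    have "(A *\<^sub>v u) $ i / sqrt (A $$ (i, i)) = \<mu> * v $ i"
      using diag_scaled_mult_vec[OF A v(1) i] v i by (simp add: u_def del: index_mult_mat_vec)
    then have *: "(A *\<^sub>v u) $ i = \<mu> * v $ i * sqrt (A $$ (i, i))"
      using s(2) by (simp add: field_simps del: index_mult_mat_vec)
    have "((?E * A) *\<^sub>v u) $ i = (A *\<^sub>v u) $ i / A $$ (i, i)"
      unfolding mult_mat_vec_index_sum[OF EA u i] mult_mat_vec_index_sum[OF A u i]
      using i by (simp add: mat_diag_mult_left[OF A] sum_divide_distrib)
    also have "\<dots> = \<mu> * v $ i * sqrt (A $$ (i, i)) / (sqrt (A $$ (i, i)) * sqrt (A $$ (i, i)))"
      unfolding * s(1) ..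
    also have "\<dots> = (\<mu> \<cdot>\<^sub>v u) $ i" using s(2) i u by (simp add: ui del: real_sqrt_mult_self)
    finally show "((?E * A) *\<^sub>v u) $ i = (\<mu> \<cdot>\<^sub>v u) $ i" .
  qed (use u in \<open>simp add: mat_diag_def\<close>)
  ultimately show ?thesis using u A
    by (auto simp: eigenvalue_def eigenvector_def mat_diag_def)
qed

text \<open>The form is bounded by some eigenvalue of \<open>diag_scaled A\<close>; this is a real
  eigenvalue of \<open>D^-1 A\<close>, hence at most the maximum of the finite spectrum.\<close>

lemma diag_scaled_le_lambda_max:
  assumes "psd_mat n A" and pos: "\<And>i. i < n \<Longrightarrow> A $$ (i, i) > 0" and n: "n \<ge> 1"
    and v: "v \<in> carrier_vec n"
  shows "v \<bullet> (diag_scaled A *\<^sub>v v) \<le> lambda_max (the (mat_inverse (diag_part A)) * A) * (v \<bullet> v)"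
proof -
  note A = psd_mat_D(1)[OF assms(1)]
  let ?E = "mat_diag n (\<lambda>i. 1 / A $$ (i, i)) * A"
  obtain \<mu> where \<mu>: "eigenvalue (diag_scaled A) \<mu>"
    "\<And>v. v \<in> carrier_vec n \<Longrightarrow> v \<bullet> (diag_scaled A *\<^sub>v v) \<le> \<mu> * (v \<bullet> v)"
    using psd_mat_max_eigenvalue[OF psd_diag_scaled[OF assms(1)] n] by blast
  have "?E \<in> carrier_mat n n" using A by (simp add: mult_carrier_mat[where n=n])
  then have "\<mu> \<le> lambda_max ?E" unfolding lambda_max_def
    using eigenvalue_diag_scaled[OF A pos \<mu>(1)]
    by (intro Max_ge card_finite_spectrum(1)) (auto simp: spectrum_def)
  then have "\<mu> * (v \<bullet> v) \<le> lambda_max ?E * (v \<bullet> v)"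
    by (intro mult_right_mono scalar_prod_self_nonneg)
  then show ?thesis using \<mu>(2)[OF v] by (simp add: mat_inverse_diag_part[OF A pos])
qed

section \<open>Gauss-Seidel sweeps as coordinate steps\<close>

text \<open>Coordinate \<open>j\<close> after \<open>t\<close> single updates:
  \<open>t div n\<close> sweeps are complete and the next one has treated the coordinates below
  \<open>t mod n\<close>.\<close>

definition sweep_point :: "nat \<Rightarrow> (nat \<Rightarrow> real vec) \<Rightarrow> nat \<Rightarrow> nat \<Rightarrow> real" where
  "sweep_point n x t j = (if j < t mod n then x (Suc (t div n)) $ j else x (t div n) $ j)"

text \<open>At the end of a sweep the quotient rises and the remainder returns to \<open>0\<close>,
  so the same vector \<open>x (Suc (t div n))\<close> is then read through the other branch.\<close>

lemma sweep_point_Suc: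
  assumes "j < n"
  shows "sweep_point n x (Suc t) j =
    (if j = t mod n then x (Suc (t div n)) $ j else sweep_point n x t j)"
  using assms by (auto simp: sweep_point_def mod_Suc div_Suc)

text \<open>The update of coordinate \<open>i\<close> reads new entries below \<open>i\<close> and
  old ones above, exactly those of the point before the step. Restoring the diagonal term turns it
  into a gradient step of length \<open>1 / A $$ (i, i)\<close>.\<close>

lemma gauss_seidel_step:
  assumes gs: "gauss_seidel n A b N x" and t: "t < n * N" and i: "i = t mod n"
    and pos: "A $$ (i, i) > 0"
  shows "sweep_point n x (Suc t) i = sweep_point n x t i
    - ((\<Sum>j<n. A $$ (i, j) * sweep_point n x t j) - b $ i) / A $$ (i, i)"
proof -
  have "n > 0" using t by (cases n) auto
  then have "i < n" by (simp add: i)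
  have c: "t div n < N" using t by (simp add: less_mult_imp_div_less mult.commute)
  let ?w = "sweep_point n x t"
  have "{..<n} = {0..<i} \<union> {i} \<union> {Suc i..<n}" using \<open>i < n\<close> by auto
  then have "(\<Sum>j<n. A $$ (i, j) * ?w j) =
      (\<Sum>j\<in>{0..<i}. A $$ (i, j) * ?w j) + A $$ (i, i) * ?w i + (\<Sum>j\<in>{Suc i..<n}. A $$ (i, j) * ?w j)"
    by (simp add: sum.union_disjoint)
  moreover have "(\<Sum>j\<in>{0..<i}. A $$ (i, j) * ?w j) = (\<Sum>j\<in>{0..<i}. A $$ (i, j) * x (Suc (t div n)) $ j)"
    "(\<Sum>j\<in>{Suc i..<n}. A $$ (i, j) * ?w j) = (\<Sum>j\<in>{Suc i..<n}. A $$ (i, j) * x (t div n) $ j)"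
    by (auto simp: sweep_point_def i intro!: sum.cong)
  moreover have "x (Suc (t div n)) $ i = 1 / A $$ (i, i) *
      (b $ i - (\<Sum>j\<in>{0..<i}. A $$ (i, j) * x (Suc (t div n)) $ j)
             - (\<Sum>j\<in>{Suc i..<n}. A $$ (i, j) * x (t div n) $ j))"
    using gs c \<open>i < n\<close> unfolding gauss_seidel_def by blast
  moreover have "sweep_point n x (Suc t) i = x (Suc (t div n)) $ i"
    using sweep_point_Suc[OF \<open>i < n\<close>] i by simp
  ultimately show ?thesis using pos by (simp add: field_simps)
qed

theorem theorem3p2:
  fixes n N :: nat and A :: "real mat" and b xstar :: "real vec"
    and x :: "nat \<Rightarrow> real vec" and L \<Delta> :: real
  assumes "n \<ge> 1" and "N \<ge> 1"
    and "psd_mat n A"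
    and "\<And>i. i < n \<Longrightarrow> A $$ (i, i) > 0"
    and "b \<in> carrier_vec n"
    and "xstar \<in> carrier_vec n" and "A *\<^sub>v xstar = b"
    and "L = lambda_max (the (mat_inverse (diag_part A)) * A)"
    and "\<Delta> \<ge> 0"
    and "(norm_D A (x 0 - xstar))\<^sup>2 \<le> \<Delta>"
    and "gauss_seidel n A b N x"
  shows "ereal (quad_fun A b (x N) - quad_fun A b xstar) \<le> pep_val n N L \<Delta>"
proof -
  note A = psd_mat_D(1,2)[OF assms(3)] and pos = assms(4)
  define s where "s i = sqrt (A $$ (i, i))" for i
  have s: "s i > 0" "s i * s i = A $$ (i, i)" if "i < n" for i
    using pos[OF that] by (auto simp: s_def)
  \<comment> \<open>The scaled trajectory \<open>D^(1/2) (x - xstar)\<close>, one vector per single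
    update.\<close>
  define y where "y t = vec n (\<lambda>j. s j * (sweep_point n x t j - xstar $ j))" for t
  have y: "y t \<in> carrier_vec n" for t by (simp add: y_def)
  have xc: "x k \<in> carrier_vec n" if "k \<le> N" for k
    using assms(11) that by (auto simp: gauss_seidel_def)
  have un: "diag_unscale A (y t) = vec n (\<lambda>j. sweep_point n x t j - xstar $ j)" for t
    by (intro eq_vecI) (use s(1) in \<open>auto simp: diag_unscale_def y_def less_imp_neq[symmetric] simp flip: s_def\<close>)
  \<comment> \<open>The original gradient scaled by \<open>D^(-1/2)\<close>;
    \<open>b = A xstar\<close> accounts for the shift of origin.\<close>
  have grad: "(diag_scaled A *\<^sub>v y t) $ i = ((\<Sum>j<n. A $$ (i, j) * sweep_point n x t j) - b $ i) / s i"
    if i: "i < n" for t i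
  proof -
    have "b $ i = (\<Sum>j<n. A $$ (i, j) * xstar $ j)"
      using mult_mat_vec_index_sum[OF A(1) assms(6) i] assms(7) by simp
    moreover have "(A *\<^sub>v diag_unscale A (y t)) $ i
        = (\<Sum>j<n. A $$ (i, j) * (sweep_point n x t j - xstar $ j))"
      using mult_mat_vec_index_sum[OF A(1) diag_unscale_carrier[OF y] i, of A t] by (simp add: un)
    ultimately show ?thesis unfolding diag_scaled_mult_vec[OF A(1) y i]
      by (simp add: s_def sum_subtractf algebra_simps)
  qed
  have "ereal (1 / 2 * (y (pep_steps n N) \<bullet> (diag_scaled A *\<^sub>v y (pep_steps n N)))) \<le> pep_val n N L \<Delta>"
  proof (rule coordinate_descent_le_pep_val[OF psd_diag_scaled[OF assms(3)] _ _ y])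
    show "diag_scaled A $$ (i, i) = 1" if "i < n" for i
      using that A pos[OF that] by (simp add: diag_scaled_def)
    show "v \<bullet> (diag_scaled A *\<^sub>v v) \<le> L * (v \<bullet> v)" if "v \<in> carrier_vec n" for v
      using diag_scaled_le_lambda_max[OF assms(3) pos assms(1) that] assms(8) by simp
    have "y 0 \<bullet> y 0 = inner_D A (x 0 - xstar) (x 0 - xstar)"
      using A(1) xc[of 0] assms(6) s(2)
      by (auto simp: scalar_prod_def inner_D_def y_def sweep_point_def atLeast0LessThan ac_simps
          simp flip: s(2) intro!: sum.cong)
    moreover have "0 \<le> inner_D A (x 0 - xstar) (x 0 - xstar)"
      unfolding inner_D_def using pos A(1)
      by (auto intro!: sum_nonneg simp: mult.assoc less_imp_le)
    ultimately show "y 0 \<bullet> y 0 \<le> \<Delta>" using assms(10) by (simp add: norm_D_def)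
    fix k i assume k: "k < pep_steps n N" and i: "i < n"
    show "y (Suc k) $ i = (if i = k mod n then y k $ i - (diag_scaled A *\<^sub>v y k) $ i else y k $ i)"
    proof (cases "i = k mod n")
      case True
      \<comment> \<open>The step length \<open>1 / A $$ (i, i)\<close> times the scaling
        \<open>s i\<close> is \<open>1 / s i\<close>, the factor already in the scaled gradient:
        hence unit steps.\<close>
      have "s i * (q / A $$ (i, i)) = q / s i" for q
        using s[OF i] by (simp flip: s(2)[OF i])
      moreover have "y (Suc k) $ i = y k $ i
          - s i * (((\<Sum>j<n. A $$ (i, j) * sweep_point n x k j) - b $ i) / A $$ (i, i))"
        using gauss_seidel_step[OF assms(11) k[unfolded pep_steps_def] True pos[OF i]] i
        by (simp only: y_def index_vec right_diff_distrib[of "s i" "sweep_point n x k i - xstar $ i", symmetric])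
           (simp add: algebra_simps)
      ultimately show ?thesis unfolding grad[OF i] using True by simp
    next
      case False
      then show ?thesis using sweep_point_Suc[OF i, of x k] i by (simp add: y_def)
    qed
  qed
  \<comment> \<open>At \<open>t = n * N\<close> the remainder is \<open>0\<close> and the quotient
    \<open>N\<close>, so every coordinate comes from \<open>x N\<close> and none from
    \<open>x (Suc N)\<close>, on which nothing is assumed.\<close>
  moreover have "diag_unscale A (y (pep_steps n N)) = x N - xstar"
    unfolding un using xc[of N] assms(1,6)
    by (intro eq_vecI) (auto simp: sweep_point_def pep_steps_def)
  ultimately have "ereal (1 / 2 * ((x N - xstar) \<bullet> (A *\<^sub>v (x N - xstar)))) \<le> pep_val n N L \<Delta>"
    by (simp add: diag_scaled_form[OF A(1) y])
  \<comment> \<open>Since \<open>A xstar = b\<close>, the linear term of the expansion at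
    \<open>xstar\<close> cancels against the terms in \<open>b\<close>.\<close>
  moreover have "quad_fun A b (x N) - quad_fun A b xstar
      = 1 / 2 * ((x N - xstar) \<bullet> (A *\<^sub>v (x N - xstar)))"
    using quadratic_form_expand[OF A xc[OF order_refl] assms(6)]
      scalar_prod_minus_distrib[OF assms(5) xc[OF order_refl] assms(6)]
    unfolding quad_fun_def assms(7) by linarith
  ultimately show ?thesis by (simp only:)
qed

end
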